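(* Let $N>2$ and let $\alpha_0,\dots,\alpha_{N-1}$ be non-zero real numbers. Consider the classical spin system of $N$ unit vectors $\mathbf{s}_0,\dots,\mathbf{s}_{N-1}\in\mathbb{R}^3$ (indices modulo $N$) in which each spin $\mathbf{s}_\mu$ is coupled only to $\mathbf{s}_{\mu+1}$ and $\mathbf{s}_{\mu-1}$, with exchange integrals $\alpha_\mu$ and $\alpha_{\mu-1}$ respectively, so that the energy is $$E(\mathbf{s}_0,\dots,\mathbf{s}_{N-1})=\sum_{\mu=0}^{N-1}\alpha_\mu\,\mathbf{s}_\mu\cdot\mathbf{s}_{\mu+1}.$$ Then every lowest energy configuration of this system is either collinear or coplanar.
   Context: A lowest energy configuration (LEC) is a configuration $(\mathbf{s}_0,\dots,\mathbf{s}_{N-1})$ of unit vectors in $\mathbb{R}^3$ that globally minimizes $E$ over all configurations of unit vectors. A configuration is collinear if the linear span of its vectors in $\mathbb{R}^3$ has dimension $1$, and coplanar if the linear span has dimension $2$. *)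

theory Defs
  imports "HOL-Analysis.Analysis"
begin

(* A configuration of N spins is a function s :: nat \<Rightarrow> real^3 of which only the values
   s 0, ..., s (N - 1) matter; likewise for the exchange integrals \<alpha> 0, ..., \<alpha> (N - 1). *)

definition spin_configuration :: "nat \<Rightarrow> (nat \<Rightarrow> real^3) \<Rightarrow> bool" where
  "spin_configuration N s \<longleftrightarrow> (\<forall>\<mu><N. norm (s \<mu>) = 1)"

definition ring_energy :: "nat \<Rightarrow> (nat \<Rightarrow> real) \<Rightarrow> (nat \<Rightarrow> real^3) \<Rightarrow> real" where
  "ring_energy N \<alpha> s = (\<Sum>\<mu><N. \<alpha> \<mu> * (s \<mu> \<bullet> s ((\<mu> + 1) mod N)))"

definition lowest_energy_configuration ::
  "nat \<Rightarrow> (nat \<Rightarrow> real) \<Rightarrow> (nat \<Rightarrow> real^3) \<Rightarrow> bool" where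
  "lowest_energy_configuration N \<alpha> s \<longleftrightarrow>
     spin_configuration N s \<and>
     (\<forall>t. spin_configuration N t \<longrightarrow> ring_energy N \<alpha> s \<le> ring_energy N \<alpha> t)"

(* These concern the linear span of the spins (through the origin), unlike the affine notions
   collinear and coplanar of the library. *)

definition collinear_configuration :: "nat \<Rightarrow> (nat \<Rightarrow> real^3) \<Rightarrow> bool" where
  "collinear_configuration N s \<longleftrightarrow> dim (span (s ` {..<N})) = 1"

definition coplanar_configuration :: "nat \<Rightarrow> (nat \<Rightarrow> real^3) \<Rightarrow> bool" where
  "coplanar_configuration N s \<longleftrightarrow> dim (span (s ` {..<N})) = 2"

end

(* Only first-order optimality matters: the energy is linear in each single spin, so a minimizing
   spin is antiparallel to its local field \<alpha>\<^bsub>\<mu>-1\<^esub> s\<^bsub>\<mu>-1\<^esub> + \<alpha>\<^bsub>\<mu>\<^esub> s\<^bsub>\<mu>+1\<^esub>.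
   Since \<alpha>\<^bsub>\<mu>\<^esub> \<noteq> 0, this three-term recurrence expresses each spin through its two
   predecessors, and all spins lie in the span of the first two. *)

theory Submission
  imports Defs
begin

text \<open>This is the equality case of Cauchy-Schwarz: comparison with the unit vector opposite to
  \<open>h\<close> pushes \<open>h \<bullet> s\<close> down to its least possible value
  \<open>- norm h\<close>.\<close>

lemma unit_minimizer_antiparallel:
  fixes h s :: "'a::real_inner"
  assumes "norm s = 1" and min: "\<And>t. norm t = 1 \<Longrightarrow> h \<bullet> s \<le> h \<bullet> t"
  shows "h = - norm h *\<^sub>R s"
proof (cases "h = 0")
  case False
  have "h \<bullet> s \<le> h \<bullet> (- (1 / norm h) *\<^sub>R h)"
    using False by (intro min) simp
  also have "\<dots> = - norm h"
    using False by (simp add: dot_square_norm power2_eq_square)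
  finally have le: "h \<bullet> s \<le> - norm h" .
  have "s \<bullet> s = 1" "h \<bullet> h = norm h * norm h"
    using assms(1) by (simp_all add: dot_square_norm power2_eq_square)
  \<comment> \<open>The squared length of the vector that has to vanish; \<open>le\<close> makes it
    nonpositive.\<close>
  then have "(h + norm h *\<^sub>R s) \<bullet> (h + norm h *\<^sub>R s) = 2 * norm h * (norm h + h \<bullet> s)"
    by (simp add: inner_left_distrib inner_right_distrib inner_commute algebra_simps)
  also have "\<dots> \<le> 0"
    using le by (simp add: mult_nonneg_nonpos)
  finally have "h + norm h *\<^sub>R s = 0"
    using inner_gt_zero_iff not_less by blast
  then show ?thesis
    by (simp add: add_eq_0_iff2)
qed simp

text \<open>Only the bonds \<open>i\<close> and \<open>Suc i\<close> contain the spin at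
  \<open>Suc i\<close>, and each is linear in it. The bound on \<open>i\<close> keeps both
  neighbours clear of the wrap-around.\<close>

lemma ring_energy_fun_upd:
  assumes "Suc (Suc i) < N"
  shows "ring_energy N \<alpha> (s(Suc i := t)) - ring_energy N \<alpha> s =
    (\<alpha> i *\<^sub>R s i + \<alpha> (Suc i) *\<^sub>R s (Suc (Suc i))) \<bullet> (t - s (Suc i))"
proof -
  let ?s = "s(Suc i := t)"
  let ?d = "\<lambda>\<mu>. \<alpha> \<mu> * (?s \<mu> \<bullet> ?s ((\<mu> + 1) mod N)) - \<alpha> \<mu> * (s \<mu> \<bullet> s ((\<mu> + 1) mod N))"
  have "ring_energy N \<alpha> ?s - ring_energy N \<alpha> s = (\<Sum>\<mu><N. ?d \<mu>)"
    by (simp add: ring_energy_def sum_subtractf)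
  also have "\<dots> = (\<Sum>\<mu>\<in>{i, Suc i}. ?d \<mu>)"
  proof (rule sum.mono_neutral_right)
    show "\<forall>\<mu>\<in>{..<N} - {i, Suc i}. ?d \<mu> = 0"
    proof
      fix \<mu> assume \<mu>: "\<mu> \<in> {..<N} - {i, Suc i}"
      \<comment> \<open>The closing bond \<open>\<mu> = N - 1\<close> leads to site 0, which is not
        a successor.\<close>
      then have "(\<mu> + 1) mod N \<noteq> Suc i"
        by (cases "\<mu> + 1 = N") auto
      with \<mu> show "?d \<mu> = 0"
        by simp
    qed
  qed (use assms in auto)
  also have "\<dots> = (\<alpha> i *\<^sub>R s i + \<alpha> (Suc i) *\<^sub>R s (Suc (Suc i))) \<bullet> (t - s (Suc i))"
    using assms by (simp add: inner_simps inner_commute algebra_simps)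
  finally show ?thesis .
qed

text \<open>Changing one spin cannot lower the energy, so that spin minimizes the inner product with
  its local field. The scalar \<open>\<kappa>\<close> is minus the norm of the field; for spans its
  existence suffices.\<close>

lemma lowest_energy_configuration_recurrence:
  assumes lec: "lowest_energy_configuration N \<alpha> s" and i: "Suc (Suc i) < N"
  obtains \<kappa> where "\<alpha> i *\<^sub>R s i + \<alpha> (Suc i) *\<^sub>R s (Suc (Suc i)) = \<kappa> *\<^sub>R s (Suc i)"
proof -
  let ?h = "\<alpha> i *\<^sub>R s i + \<alpha> (Suc i) *\<^sub>R s (Suc (Suc i))"
  have unit: "norm (s \<mu>) = 1" if "\<mu> < N" for \<mu>
    using lec that by (simp add: lowest_energy_configuration_def spin_configuration_def)
  have "?h = - norm ?h *\<^sub>R s (Suc i)"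
  proof (rule unit_minimizer_antiparallel)
    show "norm (s (Suc i)) = 1"
      using unit i by simp
    fix t :: "real^3" assume "norm t = 1"
    then have "spin_configuration N (s(Suc i := t))"
      using unit by (simp add: spin_configuration_def)
    then have "ring_energy N \<alpha> s \<le> ring_energy N \<alpha> (s(Suc i := t))"
      using lec by (simp add: lowest_energy_configuration_def)
    then show "?h \<bullet> s (Suc i) \<le> ?h \<bullet> t"
      using ring_energy_fun_upd[OF i, of \<alpha> s t] by (simp add: inner_diff_right)
  qed
  then show ?thesis
    by (rule that)
qed

lemma lowest_energy_configuration_in_span:
  assumes lec: "lowest_energy_configuration N \<alpha> s"
    and nz: "\<And>\<mu>. \<mu> < N \<Longrightarrow> \<alpha> \<mu> \<noteq> 0"
    and "\<mu> < N"
  shows "s \<mu> \<in> span {s 0, s 1}"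
  using \<open>\<mu> < N\<close>
proof (induction \<mu> rule: induct_nat_012)
  case (ge2 i)
  obtain \<kappa> where "\<alpha> i *\<^sub>R s i + \<alpha> (Suc i) *\<^sub>R s (Suc (Suc i)) = \<kappa> *\<^sub>R s (Suc i)"
    using lowest_energy_configuration_recurrence[OF lec ge2.prems] .
  then have "\<alpha> (Suc i) *\<^sub>R s (Suc (Suc i)) = \<kappa> *\<^sub>R s (Suc i) - \<alpha> i *\<^sub>R s i"
    by (simp add: algebra_simps)
  also have "\<dots> \<in> span {s 0, s 1}"
    using ge2 by (intro span_diff span_scale) auto
  \<comment> \<open>Division by the non-zero coupling isolates the newest spin.\<close>
  finally have "inverse (\<alpha> (Suc i)) *\<^sub>R \<alpha> (Suc i) *\<^sub>R s (Suc (Suc i)) \<in> span {s 0, s 1}"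
    by (rule span_scale)
  then show ?case
    using nz[of "Suc i"] ge2.prems by simp
qed (auto intro: span_base)

theorem theorem1:
  fixes N :: nat and \<alpha> :: "nat \<Rightarrow> real" and s :: "nat \<Rightarrow> real^3"
  assumes "N > 2"
    and "\<And>\<mu>. \<mu> < N \<Longrightarrow> \<alpha> \<mu> \<noteq> 0"
    and "lowest_energy_configuration N \<alpha> s"
  shows "collinear_configuration N s \<or> coplanar_configuration N s"
proof -
  let ?S = "s ` {..<N}"
  have "?S \<subseteq> span {s 0, s 1}"
    using lowest_energy_configuration_in_span[OF assms(3,2)] by blast
  then have "dim ?S \<le> card {s 0, s 1}"
    by (rule dim_le_card) simp
  \<comment> \<open>An inequality, since \<open>s 0\<close> and \<open>s 1\<close> may
    coincide.\<close>
  also have "\<dots> \<le> 2"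
    by (simp add: card_insert_if)
  finally have "dim ?S \<le> 2" .
  \<comment> \<open>A unit vector in the set excludes dimension 0.\<close>
  moreover have "dim ?S \<noteq> 0"
  proof -
    have "norm (s 0) = 1"
      using assms(1,3) by (simp add: lowest_energy_configuration_def spin_configuration_def)
    then have "s 0 \<in> ?S" "s 0 \<noteq> 0"
      using assms(1) by auto
    then show ?thesis
      by (auto simp: dim_eq_0)
  qed
  ultimately have "dim ?S = 1 \<or> dim ?S = 2"
    by linarith
  then show ?thesis
    by (simp add: collinear_configuration_def coplanar_configuration_def)
qed

end
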